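(* Let $r$ and $s$ be non-negative integers and let $G$ be a non-bipartite graph with circular chromatic number $\chi_c(G)$. If $\frac{2r+1}{2s+1}<\frac{\chi_c(G)}{\chi_c(G)-2}$, then $$\chi_c\big(G^{\frac{2r+1}{2s+1}}\big)\le \frac{(2s+1)\chi_c(G)}{(s-r)\chi_c(G)+2r+1}.$$
   Context: All graphs are finite simple graphs. For positive integers $n\ge 2d$, the circular complete graph $K_{n/d}$ has vertex set $\{0,\dots,n-1\}$ with $ij$ an edge iff $d\le|i-j|\le n-d$. The circular chromatic number is $\chi_c(G)=\inf\{\frac nd : G\to K_{n/d}\}$, where $G\to H$ means there is a graph homomorphism (a vertex map sending edges to edges). For a positive integer $k$, $G^{k}$ is the graph on $V(G)$ in which $u,v$ are adjacent iff there is a walk of length exactly $k$ between them in $G$ (a vertex lying on a closed walk of length $k$ receives a loop). For a positive integer $s$, $G^{1/s}$ is the graph obtained from $G$ by replacing each edge by a path with $s$ edges (i.e. subdividing each edge with $s-1$ new vertices), and $G^{r/s}=(G^{1/s})^{r}$. *)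

theory Defs
  imports "Graph_Theory.Graph_Theory" "HOL-Library.Extended_Real"
begin

text \<open>
  Finite simple graphs are the symmetric loop-free finite digraphs of locale \<^locale>\<open>pair_graph\<close>:
  an undirected edge is a pair of opposite arcs.  Since powers of a graph may have loops, the notions
  below are defined for the underlying record type.
\<close>

definition bipartite :: "'a pair_pre_digraph \<Rightarrow> bool" where
  "bipartite G \<longleftrightarrow> (\<exists>X Y. pverts G = X \<union> Y \<and> X \<inter> Y = {} \<and> parcs G \<subseteq> X \<times> Y \<union> Y \<times> X)"

definition graph_hom :: "('a \<Rightarrow> 'b) \<Rightarrow> 'a pair_pre_digraph \<Rightarrow> 'b pair_pre_digraph \<Rightarrow> bool" where
  "graph_hom f G H \<longleftrightarrow> f ` pverts G \<subseteq> pverts H \<and> (\<forall>(u, v) \<in> parcs G. (f u, f v) \<in> parcs H)"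

definition homomorphic_to :: "'a pair_pre_digraph \<Rightarrow> 'b pair_pre_digraph \<Rightarrow> bool" where
  "homomorphic_to G H \<longleftrightarrow> (\<exists>f. graph_hom f G H)"

definition circular_complete :: "nat \<Rightarrow> nat \<Rightarrow> nat pair_pre_digraph" where
  "circular_complete n d =
     \<lparr> pverts = {0..<n},
       parcs = {(i, j). i < n \<and> j < n \<and>
                  int d \<le> \<bar>int i - int j\<bar> \<and> \<bar>int i - int j\<bar> \<le> int n - int d} \<rparr>"

text \<open>
  The infimum is taken in \<^typ>\<open>ereal\<close>, so that it is \<open>\<infinity>\<close> when there is no
  homomorphism to any circular complete graph (that is, when the graph has a loop).
\<close>

definition circular_chromatic_number :: "'a pair_pre_digraph \<Rightarrow> ereal" where
  "circular_chromatic_number G =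
     Inf {ereal (real n / real d) | n d. 0 < d \<and> 2 * d \<le> n \<and>
            homomorphic_to G (circular_complete n d)}"

definition graph_power :: "'a pair_pre_digraph \<Rightarrow> nat \<Rightarrow> 'a pair_pre_digraph" where
  "graph_power G k =
     \<lparr> pverts = pverts G,
       parcs = {(u, v). \<exists>p. pre_digraph.awalk (with_proj G) u p v \<and> length p = k} \<rparr>"

text \<open>
  The vertex \<open>New {(u, i), (v, s - i)}\<close> lies on the path of length \<open>s\<close> replacing the edge \<open>uv\<close>, at
  distance \<open>i\<close> from \<open>u\<close> and \<open>s - i\<close> from \<open>v\<close> along this path.  This description does not depend on
  the direction in which the edge is traversed:
  \<open>subdiv_point s u v i = subdiv_point s v u (s - i)\<close> for \<open>i \<le> s\<close> and \<open>0 < s\<close>.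
\<close>

datatype 'a subdiv_vertex = Old 'a | New "('a \<times> nat) set"

definition subdiv_point :: "nat \<Rightarrow> 'a \<Rightarrow> 'a \<Rightarrow> nat \<Rightarrow> 'a subdiv_vertex" where
  "subdiv_point s u v i =
     (if i = 0 then Old u else if i = s then Old v else New {(u, i), (v, s - i)})"

definition edge_subdivision :: "'a pair_pre_digraph \<Rightarrow> nat \<Rightarrow> 'a subdiv_vertex pair_pre_digraph" where
  "edge_subdivision G s =
     \<lparr> pverts = Old ` pverts G \<union> {subdiv_point s u v i | u v i. (u, v) \<in> parcs G \<and> 0 < i \<and> i < s},
       parcs = {(subdiv_point s u v i, subdiv_point s u v (Suc i)) | u v i.
                  (u, v) \<in> parcs G \<and> i < s} \<rparr>"

definition fractional_power ::
    "'a pair_pre_digraph \<Rightarrow> nat \<Rightarrow> nat \<Rightarrow> 'a subdiv_vertex pair_pre_digraph" where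
  "fractional_power G r s = graph_power (edge_subdivision G s) r"

lemma subdiv_point_sym:
  assumes "0 < s" "i \<le> s"
  shows "subdiv_point s v u (s - i) = subdiv_point s u v i"
  using assms by (auto simp: subdiv_point_def insert_commute)

lemma subdiv_point_neq:
  assumes "u \<noteq> v" "i < s"
  shows "subdiv_point s u v i \<noteq> subdiv_point s u v (Suc i)"
  using assms by (auto simp: subdiv_point_def doubleton_eq_iff)

lemma pair_graph_edge_subdivision:
  assumes "pair_graph G" "0 < s"
  shows "pair_graph (edge_subdivision G s)"
proof -
  interpret pair_graph G by fact
  let ?H = "edge_subdivision G s"
  have in_verts: "subdiv_point s u v i \<in> pverts ?H" if "(u, v) \<in> parcs G" "i \<le> s" for u v i
  proof (cases "i = 0 \<or> i = s")
    case True
    then show ?thesis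
      using that assms(2) in_arcsD1 in_arcsD2
      by (auto simp: edge_subdivision_def subdiv_point_def)
  next
    case False
    then have "0 < i" "i < s" using that by auto
    then show ?thesis using that(1) unfolding edge_subdivision_def pair_pre_digraph.simps by blast
  qed
  have wf: "fst e \<in> pverts ?H \<and> snd e \<in> pverts ?H" if e: "e \<in> parcs ?H" for e
  proof -
    from e obtain u v i where "e = (subdiv_point s u v i, subdiv_point s u v (Suc i))"
        "(u, v) \<in> parcs G" "i < s"
      by (auto simp: edge_subdivision_def)
    then show ?thesis using in_verts[of u v i] in_verts[of u v "Suc i"] by simp
  qed
  have "pverts ?H \<subseteq> Old ` pverts G \<union> (\<lambda>((u, v), i). subdiv_point s u v i) ` (parcs G \<times> {..<s})"
    by (force simp: edge_subdivision_def)
  then have fin: "finite (pverts ?H)"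
    by (rule finite_subset) (simp add: pair_finite_verts pair_finite_arcs)
  have "parcs ?H \<subseteq> pverts ?H \<times> pverts ?H" using wf by force
  then have fin': "finite (parcs ?H)" by (rule finite_subset) (simp add: fin)
  have loop: "fst e \<noteq> snd e" if e: "e \<in> parcs ?H" for e
  proof -
    from e obtain u v i where "e = (subdiv_point s u v i, subdiv_point s u v (Suc i))"
        "(u, v) \<in> parcs G" "i < s"
      by (auto simp: edge_subdivision_def)
    then show ?thesis using subdiv_point_neq[of u v i s] pair_no_loops by force
  qed
  have sym: "(y, x) \<in> parcs ?H" if xy: "(x, y) \<in> parcs ?H" for x y
  proof -
    from xy obtain u v i where *: "x = subdiv_point s u v i" "y = subdiv_point s u v (Suc i)"
        "(u, v) \<in> parcs G" "i < s"
      by (auto simp: edge_subdivision_def)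
    have "(v, u) \<in> parcs G" using *(3) pair_sym_arcs by (auto simp: symmetric_def elim: symE)
    moreover have "y = subdiv_point s v u (s - Suc i)"
      using * subdiv_point_sym[of s "Suc i" v u] assms(2) by simp
    moreover have "x = subdiv_point s v u (Suc (s - Suc i))"
      using * subdiv_point_sym[of s i v u] assms(2) by (simp add: Suc_diff_Suc)
    moreover have "s - Suc i < s" using assms(2) by simp
    ultimately show ?thesis unfolding edge_subdivision_def pair_pre_digraph.simps by blast
  qed
  show ?thesis
    using wf fin fin' loop sym by unfold_locales (auto simp: symmetric_def intro: symI)
qed

lemma circular_chromatic_number_finite:
  assumes "pair_graph G"
  shows "\<bar>circular_chromatic_number G\<bar> \<noteq> \<infinity>"
proof -
  interpret pair_graph G by fact
  define n where "n = card (pverts G) + 2"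
  obtain f where f: "bij_betw f (pverts G) {0..<card (pverts G)}"
    using ex_bij_betw_finite_nat[OF pair_finite_verts] by blast
  have im: "f u < n" if "u \<in> pverts G" for u
  proof -
    have "f u \<in> {0..<card (pverts G)}" using bij_betwE[OF f] that by blast
    then show ?thesis by (simp add: n_def)
  qed
  have "(f u, f v) \<in> parcs (circular_complete n 1)" if uv: "(u, v) \<in> parcs G" for u v
  proof -
    have "u \<in> pverts G" "v \<in> pverts G" "u \<noteq> v"
      using uv in_arcsD1 in_arcsD2 pair_no_loops by force+
    then have "f u \<noteq> f v" "f u < n" "f v < n"
      using bij_betw_imp_inj_on[OF f] im by (simp_all add: inj_on_eq_iff)
    then show ?thesis by (auto simp: circular_complete_def)
  qed
  then have "homomorphic_to G (circular_complete n 1)"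
    using im unfolding homomorphic_to_def graph_hom_def
    by (intro exI[of _ f]) (auto simp: circular_complete_def)
  then have "circular_chromatic_number G \<le> ereal (real n / real (1 :: nat))"
    unfolding circular_chromatic_number_def
    by (intro Inf_lower CollectI exI[of _ n] exI[of _ "1 :: nat"]) (simp add: n_def)
  moreover have "0 \<le> circular_chromatic_number G"
    unfolding circular_chromatic_number_def by (intro Inf_greatest) auto
  ultimately show ?thesis by auto
qed

end

(* A homomorphism to the circular complete graph K_{n/d} places the vertices on a circle of length n so
   that every edge advances by n/2 + e with |e| \<le> n/2 - d.  On an edge subdivided into 2s+1 pieces, let
   each piece advance by n/2 + e/(2s+1): the half turns of the 2s+1 pieces add up to a single one modulo n.
   A walk of length 2r+1 in the subdivision then advances by n/2 up to an error of at most
   (2r+1)/(2s+1) (n/2 - d), again because 2r+1 half turns are one half turn modulo n.  Multiplying all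
   lengths by 2s+1 keeps everything integral.  The bound for the circular chromatic number follows by
   letting n/d tend to it. *)

theory Submission
  imports Defs "HOL-Number_Theory.Cong"
begin

section \<open>Homomorphisms to circular complete graphs as residues modulo \<open>n\<close>\<close>

text \<open>The interval from \<open>d\<close> to \<open>n - d\<close> is invariant under exchanging
  \<open>k\<close> and \<open>n - k\<close>, so it does not matter which way round the circle a
  distance is measured.\<close>

lemma circular_complete_arc_iff:
  assumes "0 < d"
  shows "(i, j) \<in> parcs (circular_complete n d) \<longleftrightarrow>
    i < n \<and> j < n \<and> (int j - int i) mod int n \<in> {int d..int n - int d}"
proof (cases "i < n \<and> j < n")
  case True
  show ?thesis
  proof (cases "i \<le> j")
    case True
    with \<open>i < n \<and> j < n\<close> show ?thesis
      by (auto simp: circular_complete_def)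
  next
    case False
    with \<open>i < n \<and> j < n\<close> have "(int j - int i) mod int n = int j - int i + int n"
      by (subst mod_add_self2[symmetric], intro mod_pos_pos_trivial) auto
    with False True show ?thesis
      by (auto simp: circular_complete_def)
  qed
qed (auto simp: circular_complete_def)

text \<open>Integer placements can be scaled, and their differences added along walks, without
  keeping values in range; reduction modulo \<open>n\<close> turns them back into a vertex
  map.\<close>

lemma homomorphic_to_circular_complete_iff:
  fixes G :: "'a pair_pre_digraph"
  assumes "0 < d" "0 < n"
  shows "homomorphic_to G (circular_complete n d) \<longleftrightarrow>
    (\<exists>c :: 'a \<Rightarrow> int. \<forall>(u, v) \<in> parcs G. (c v - c u) mod int n \<in> {int d..int n - int d})"
    (is "?L \<longleftrightarrow> (\<exists>c. ?R c)")
proof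
  assume ?L
  then obtain f where "graph_hom f G (circular_complete n d)"
    unfolding homomorphic_to_def ..
  then have "?R (\<lambda>u. int (f u))"
    using circular_complete_arc_iff[OF \<open>0 < d\<close>] by (fastforce simp: graph_hom_def)
  then show "\<exists>c. ?R c" by (rule exI[of ?R])
next
  assume "\<exists>c. ?R c"
  then obtain c where c: "?R c" ..
  have "graph_hom (\<lambda>u. nat (c u mod int n)) G (circular_complete n d)"
    using c \<open>0 < n\<close>
    by (auto simp: graph_hom_def circular_complete_arc_iff[OF \<open>0 < d\<close>] mod_diff_eq nat_less_iff)
      (auto simp: circular_complete_def nat_less_iff)
  then show ?L unfolding homomorphic_to_def by blast
qed

section \<open>Subdivision into an odd number of pieces\<close>

text \<open>On the scaled circle a half turn is \<open>(2 * s + 1) * n / 2\<close>. Subtracting the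
  slack \<open>n / 2 - d\<close>, which scaling and division among the pieces leave unchanged, gives
  \<open>s * n + d\<close>.\<close>

lemma homomorphic_to_circular_complete_edge_subdivision:
  fixes G :: "'a pair_pre_digraph"
  assumes G: "symmetric (with_proj G)" and "0 < d" "0 < n"
    and hom: "homomorphic_to G (circular_complete n d)"
  shows "homomorphic_to (edge_subdivision G (2 * s + 1))
    (circular_complete ((2 * s + 1) * n) (s * n + d))"
proof -
  define S where "S = 2 * s + 1"
  obtain c :: "'a \<Rightarrow> int" where
    c: "\<And>u v. (u, v) \<in> parcs G \<Longrightarrow> (c v - c u) mod int n \<in> {int d..int n - int d}"
    using hom homomorphic_to_circular_complete_iff[OF \<open>0 < d\<close> \<open>0 < n\<close>] by fastforce
  \<comment> \<open>This is the scaled half turn \<open>S * n / 2\<close> plus the deviation of the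
    residue from \<open>n / 2\<close>.\<close>
  define step where "step u v = int s * int n + (c v - c u) mod int n" for u v
  define h where "h u v i = int S * c u + int i * step u v" for u v i
  have sym: "(v, u) \<in> parcs G" if "(u, v) \<in> parcs G" for u v
    using G that by (auto simp: symmetric_def elim: symE)
  \<comment> \<open>As \<open>0 < d\<close>, the residue is not 0, so opposite residues add up to
    \<open>n\<close> and opposite steps to one full turn \<open>S * n\<close>.\<close>
  have step_rev: "step v u = int S * int n - step u v" if "(u, v) \<in> parcs G" for u v
  proof -
    have "(c v - c u) mod int n \<noteq> 0"
      using c[OF that] \<open>0 < d\<close> by auto
    then have "(c u - c v) mod int n = int n - (c v - c u) mod int n"
      using zmod_zminus1_eq_if[of "c v - c u" "int n"] by simp
    then show ?thesis
      by (simp add: step_def S_def algebra_simps)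
  qed
  \<comment> \<open>The \<open>S\<close> pieces contribute \<open>s\<close> full turns and
    \<open>S\<close> times the residue, and the residue differs from \<open>c v - c u\<close> by a
    multiple of \<open>n\<close>.\<close>
  have h_end: "[h u v S = int S * c v] (mod int S * int n)" for u v
  proof -
    have "h u v S - int S * c v =
        int S * (int s * int n - ((c v - c u) - (c v - c u) mod int n))"
      by (simp add: h_def step_def algebra_simps)
    also have "\<dots> = (int S * int n) * (int s - (c v - c u) div int n)"
      by (simp add: minus_mod_eq_mult_div algebra_simps)
    finally show ?thesis
      by (simp add: cong_iff_dvd_diff)
  qed
  have h_rev: "[h v u (S - i) = h u v i] (mod int S * int n)"
    if "(u, v) \<in> parcs G" "i \<le> S" for u v i
  proof -
    have "h v u (S - i) = int S * c v - (int S - int i) * step u v + int S * int n * (int S - int i)"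
      using that by (simp add: h_def step_rev of_nat_diff algebra_simps)
    also have "[\<dots> = h u v S - (int S - int i) * step u v + 0] (mod int S * int n)"
      by (intro cong_add cong_diff cong_sym[OF h_end] cong_refl) (simp add: cong_0_iff)
    also have "h u v S - (int S - int i) * step u v + 0 = h u v i"
      by (simp add: h_def algebra_simps)
    finally show ?thesis .
  qed
  \<comment> \<open>The set \<open>A\<close> can be read from either end of the edge. By
    \<open>h_rev\<close> both readings give the same value modulo \<open>S * n\<close>, so the
    arbitrary choice in \<open>c'\<close> is harmless.\<close>
  define Q where "Q A z \<longleftrightarrow> (\<exists>u v i. (u, v) \<in> parcs G \<and> 0 < i \<and> i < S \<and>
    A = {(u, i), (v, S - i)} \<and> z = h u v i)" for A z
  define c' where "c' x = (case x of Old u \<Rightarrow> int S * c u | New A \<Rightarrow> (SOME z. Q A z))" for x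
  have c': "[c' (subdiv_point S u v i) = h u v i] (mod int S * int n)"
    if uv: "(u, v) \<in> parcs G" and "i \<le> S" for u v i
  proof -
    consider "i = 0" | "i = S" "0 < i" | "0 < i" "i < S"
      using \<open>i \<le> S\<close> by linarith
    then show ?thesis
    proof cases
      case 1
      then show ?thesis by (simp add: subdiv_point_def c'_def h_def)
    next
      case 2
      then show ?thesis
        using cong_sym[OF h_end] by (simp add: subdiv_point_def c'_def)
    next
      case 3
      define A where "A = {(u, i), (v, S - i)}"
      have "Q A (h u v i)"
        unfolding Q_def A_def using uv 3 by blast
      then have "Q A (SOME z. Q A z)" by (rule someI)
      then obtain u' v' i' where *: "i' < S" "A = {(u', i'), (v', S - i')}"
          "(SOME z. Q A z) = h u' v' i'"
        unfolding Q_def by blast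
      then have "u' = u \<and> v' = v \<and> i' = i \<or> u' = v \<and> v' = u \<and> i' = S - i"
        using 3 by (auto simp: A_def doubleton_eq_iff)
      then have "[h u' v' i' = h u v i] (mod int S * int n)"
        using h_rev[OF uv \<open>i \<le> S\<close>] by auto
      then show ?thesis
        using 3 * by (simp add: subdiv_point_def c'_def flip: A_def)
    qed
  qed
  have "(c' y - c' x) mod int (S * n) \<in> {int (s * n + d)..int (S * n) - int (s * n + d)}"
    if arc: "(x, y) \<in> parcs (edge_subdivision G S)" for x y
  proof -
    obtain u v i where uv: "(u, v) \<in> parcs G" and "i < S"
      and xy: "x = subdiv_point S u v i" "y = subdiv_point S u v (Suc i)"
      using arc unfolding edge_subdivision_def pair_pre_digraph.simps by blast
    have "[c' y - c' x = h u v (Suc i) - h u v i] (mod int S * int n)"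
      unfolding xy using uv \<open>i < S\<close> by (intro cong_diff c') auto
    also have "h u v (Suc i) - h u v i = step u v"
      by (simp add: h_def algebra_simps)
    finally have "(c' y - c' x) mod int (S * n) = step u v mod int (S * n)"
      by (simp add: cong_def)
    moreover have step: "step u v \<in> {int (s * n + d)..int (S * n) - int (s * n + d)}"
      using c[OF uv] by (auto simp: step_def S_def algebra_simps)
    moreover have "step u v mod int (S * n) = step u v"
    proof (rule mod_pos_pos_trivial)
      show "0 \<le> step u v"
        using step by (meson atLeastAtMost_iff of_nat_0_le_iff order_trans)
      show "step u v < int (S * n)"
        using step \<open>0 < d\<close> unfolding atLeastAtMost_iff by linarith
    qed
    ultimately show ?thesis by simp
  qed
  then show ?thesis
    unfolding S_def[symmetric] using \<open>0 < d\<close> \<open>0 < n\<close>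
    by (subst homomorphic_to_circular_complete_iff) (auto simp: S_def)
qed

section \<open>Odd powers\<close>

text \<open>Differences telescope along the walk. The sum of the residues is kept unreduced so that
  its range stays an interval, from which whole turns can be subtracted later.\<close>

lemma cas_cong_sum:
  fixes c :: "'a \<Rightarrow> int"
  assumes "pre_digraph.cas (with_proj H) u p v" "set p \<subseteq> parcs H"
    and "\<And>x y. (x, y) \<in> parcs H \<Longrightarrow> (c y - c x) mod n \<in> {a..b}"
  shows "\<exists>t \<in> {int (length p) * a..int (length p) * b}. [c v - c u = t] (mod n)"
  using assms(1,2)
proof (induction p arbitrary: u)
  case Nil
  then show ?case by (auto simp: pre_digraph.cas.simps)
next
  case (Cons e p)
  obtain w where e: "e = (u, w)" and "pre_digraph.cas (with_proj H) w p v"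
    using Cons.prems(1) by (cases e) (auto simp: pre_digraph.cas.simps)
  then obtain t where t: "t \<in> {int (length p) * a..int (length p) * b}" "[c v - c w = t] (mod n)"
    using Cons.IH[of w] Cons.prems(2) by auto
  have "[(c v - c w) + (c w - c u) = t + (c w - c u) mod n] (mod n)"
    by (intro cong_add t) (simp add: cong_def)
  moreover have "(c w - c u) mod n \<in> {a..b}"
    using assms(3) Cons.prems(2) e by auto
  ultimately show ?case
    using t(1) by (intro bexI[of _ "t + (c w - c u) mod n"]) (auto simp: algebra_simps)
qed

text \<open>The sum of \<open>2 * r + 1\<close> residues lies in an interval centred at
  \<open>(2 * r + 1) * n / 2\<close>; removing \<open>r\<close> full turns centres it at
  \<open>n / 2\<close>, with lower end \<open>d'\<close>. The additive form of the equation for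
  \<open>d'\<close> avoids truncated subtraction.\<close>

lemma homomorphic_to_circular_complete_odd_power:
  fixes H :: "'a pair_pre_digraph"
  assumes "0 < d" "0 < n" "0 < d'"
    and d': "d' + r * n = (2 * r + 1) * d"
    and hom: "homomorphic_to H (circular_complete n d)"
  shows "homomorphic_to (graph_power H (2 * r + 1)) (circular_complete n d')"
proof -
  obtain c :: "'a \<Rightarrow> int" where
    c: "\<And>u v. (u, v) \<in> parcs H \<Longrightarrow> (c v - c u) mod int n \<in> {int d..int n - int d}"
    using hom homomorphic_to_circular_complete_iff[OF \<open>0 < d\<close> \<open>0 < n\<close>] by fastforce
  have d'_int: "int (2 * r + 1) * int d = int d' + int r * int n"
    using d' by (metis of_nat_add of_nat_mult)
  have "(c v - c u) mod int n \<in> {int d'..int n - int d'}"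
    if uv: "(u, v) \<in> parcs (graph_power H (2 * r + 1))" for u v
  proof -
    obtain p where "pre_digraph.cas (with_proj H) u p v" "set p \<subseteq> parcs H" and len: "length p = 2 * r + 1"
      using uv by (auto simp: graph_power_def pre_digraph.awalk_def)
    then obtain t where t: "t \<in> {int (2 * r + 1) * int d..int (2 * r + 1) * (int n - int d)}"
        "[c v - c u = t] (mod int n)"
      using cas_cong_sum[of H u p v c "int n" "int d" "int n - int d"] c by (metis len)
    have "int (2 * r + 1) * (int n - int d) = (int n - int d') + int r * int n"
      using d'_int by (simp add: algebra_simps)
    with t(1) d'_int have range: "t - int r * int n \<in> {int d'..int n - int d'}"
      by auto
    have "(c v - c u) mod int n = (t - int r * int n) mod int n"
      using t(2) by (simp add: cong_def)
        (metis mod_diff_right_eq mod_mult_self2_is_0 diff_zero)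
    \<comment> \<open>Since \<open>0 < d'\<close>, the shifted interval lies strictly between 0 and
      \<open>n\<close>, so no further reduction occurs.\<close>
    also have "\<dots> = t - int r * int n"
      using range \<open>0 < d'\<close> by (intro mod_pos_pos_trivial) auto
    finally show ?thesis using range by simp
  qed
  then show ?thesis
    using homomorphic_to_circular_complete_iff[OF \<open>0 < d'\<close> \<open>0 < n\<close>] by blast
qed

section \<open>Bounds on the circular chromatic number\<close>

lemma circular_chromatic_number_le:
  assumes "0 < d" "2 * d \<le> n" "homomorphic_to G (circular_complete n d)"
  shows "circular_chromatic_number G \<le> ereal (real n / real d)"
  unfolding circular_chromatic_number_def using assms by (intro Inf_lower) blast

lemma circular_chromatic_number_ge_2: "2 \<le> circular_chromatic_number G"
  unfolding circular_chromatic_number_def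
proof (intro Inf_greatest, clarify)
  fix n d :: nat
  assume "0 < d" "2 * d \<le> n"
  then have "2 \<le> real n / real d"
    by (simp add: field_simps flip: of_nat_mult)
  then show "2 \<le> ereal (real n / real d)"
    by (metis ereal_less_eq(3) numeral_eq_ereal)
qed

text \<open>Subdivision followed by the odd power gives a homomorphism to the circular complete
  graph of \<open>N\<close> and \<open>D\<close>. Writing \<open>N / D\<close> as a function of
  \<open>t\<close> prepares the passage to the limit.\<close>

lemma circular_chromatic_number_odd_fractional_power_le:
  fixes G :: "'a pair_pre_digraph"
  assumes G: "symmetric (with_proj G)" and "0 < d" "2 * d \<le> n"
    and hom: "homomorphic_to G (circular_complete n d)"
    and t: "t = real n / real d" and pos: "0 < (real s - real r) * t + real (2 * r + 1)"
  shows "circular_chromatic_number (fractional_power G (2 * r + 1) (2 * s + 1))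
    \<le> ereal (real (2 * s + 1) * t / ((real s - real r) * t + real (2 * r + 1)))"
proof -
  define N where "N = (2 * s + 1) * n"
  \<comment> \<open>This is \<open>(2 * r + 1) * (s * n + d) - r * N\<close> expanded, taken in the
    integers because \<open>s - r\<close> may be negative. It equals \<open>d\<close> times the
    denominator in the bound, whence its positivity.\<close>
  define z where "z = (int s - int r) * int n + int (2 * r + 1) * int d"
  have z_real: "real_of_int z = real d * ((real s - real r) * t + real (2 * r + 1))"
  proof -
    have "real n = real d * t"
      using \<open>0 < d\<close> by (simp add: t)
    then show ?thesis
      by (simp add: z_def algebra_simps)
  qed
  then have "0 < real_of_int z"
    using pos \<open>0 < d\<close> by simp
  then have "0 < z" by simp
  define D where "D = nat z"
  have D: "int D = z" "0 < D"
    using \<open>0 < z\<close> by (auto simp: D_def)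
  have "int (D + r * N) = int ((2 * r + 1) * (s * n + d))"
    by (simp add: D N_def z_def algebra_simps)
  then have DN: "D + r * N = (2 * r + 1) * (s * n + d)"
    by (simp only: of_nat_eq_iff)
  \<comment> \<open>The slack \<open>n - 2 * d\<close> of the given graph is multiplied by
    \<open>2 * r + 1\<close>; its nonnegativity makes the pair \<open>N\<close>, \<open>D\<close>
    admissible.\<close>
  have "2 * D + (2 * r + 1) * (n - 2 * d) = N"
  proof -
    have "int (n - 2 * d) = int n - 2 * int d"
      using \<open>2 * d \<le> n\<close> by simp
    then have "int (2 * D + (2 * r + 1) * (n - 2 * d)) = int N"
      unfolding of_nat_add of_nat_mult D N_def z_def by (simp add: algebra_simps)
    then show ?thesis by (simp only: of_nat_eq_iff)
  qed
  then have "2 * D \<le> N" by simp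
  have "0 < n" using assms by simp
  have "homomorphic_to (fractional_power G (2 * r + 1) (2 * s + 1)) (circular_complete N D)"
    unfolding fractional_power_def
    using homomorphic_to_circular_complete_edge_subdivision[OF G \<open>0 < d\<close> \<open>0 < n\<close> hom, of s]
      \<open>0 < d\<close> \<open>0 < n\<close> D(2) DN
    by (intro homomorphic_to_circular_complete_odd_power[of "s * n + d"]) (auto simp: N_def)
  from circular_chromatic_number_le[OF D(2) \<open>2 * D \<le> N\<close> this]
  have "circular_chromatic_number (fractional_power G (2 * r + 1) (2 * s + 1)) \<le> ereal (real N / real D)" .
  also have "real D = real_of_int z"
    using D(1) by (metis of_int_of_nat_eq)
  also have "real N / real_of_int z =
      real (2 * s + 1) * t / ((real s - real r) * t + real (2 * r + 1))"
  proof -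
    have "real N = real d * (real (2 * s + 1) * t)"
      using \<open>0 < d\<close> by (simp add: N_def t algebra_simps)
    with z_real \<open>0 < d\<close> show ?thesis by simp
  qed
  finally show ?thesis .
qed

section \<open>Limit along ratios tending to the circular chromatic number\<close>

theorem theorem1:
  fixes G :: "'a pair_pre_digraph" and r s :: nat
  assumes "pair_graph G"
    and "\<not> bipartite G"
    and "real (2 * r + 1) / real (2 * s + 1)
         < real_of_ereal (circular_chromatic_number G) /
           (real_of_ereal (circular_chromatic_number G) - 2)"
  shows "circular_chromatic_number (fractional_power G (2 * r + 1) (2 * s + 1))
         \<le> ereal (real (2 * s + 1) * real_of_ereal (circular_chromatic_number G) /
             ((real s - real r) * real_of_ereal (circular_chromatic_number G) + real (2 * r + 1)))"
proof -
  interpret pair_graph G by fact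
  define x where "x = real_of_ereal (circular_chromatic_number G)"
  have x: "circular_chromatic_number G = ereal x"
    using circular_chromatic_number_finite[OF assms(1)] by (simp add: x_def ereal_real')
  have "2 \<le> x"
    using circular_chromatic_number_ge_2[of G] by (simp add: x)
  \<comment> \<open>As \<open>x / 0 = 0\<close>, the hypothesis excludes \<open>x = 2\<close>.\<close>
  moreover have "x \<noteq> 2"
  proof
    assume "x = 2"
    then show False using assms(3) by (simp add: x_def[symmetric] divide_less_0_iff)
  qed
  ultimately have "2 < x" by simp
  define den where "den t = (real s - real r) * t + real (2 * r + 1)" for t
  define bound where "bound t = real (2 * s + 1) * t / den t" for t
  \<comment> \<open>After clearing denominators, the difference of the two sides is exactly
    \<open>2 * den x\<close>.\<close>
  have "real (2 * r + 1) * (x - 2) < real (2 * s + 1) * x"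
    using assms(3) \<open>2 < x\<close> unfolding x_def[symmetric] by (simp add: field_simps)
  then have "0 < den x"
    by (simp add: den_def algebra_simps)
  have "isCont den x"
    unfolding den_def by (intro continuous_intros)
  \<comment> \<open>One-sided limits suffice, as no admissible ratio lies below
    \<open>x\<close>.\<close>
  then have lim_den: "(den \<longlongrightarrow> den x) (at_right x)"
    unfolding isCont_def by (rule tendsto_within_subset) simp
  have lim: "(bound \<longlongrightarrow> bound x) (at_right x)"
    unfolding bound_def using \<open>0 < den x\<close> by (intro tendsto_intros lim_den) auto
  have "circular_chromatic_number (fractional_power G (2 * r + 1) (2 * s + 1)) \<le> ereal (bound x)"
  proof (rule ereal_le_epsilon2)
    fix e :: real
    assume "0 < e"
    \<comment> \<open>For \<open>s < r\<close> the function \<open>den\<close> is decreasing, so its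
      positivity at \<open>x\<close> carries over only to ratios close to \<open>x\<close>.\<close>
    have "\<forall>\<^sub>F t in at_right x. 0 < den t \<and> bound t < bound x + e"
      using order_tendstoD(1)[OF lim_den \<open>0 < den x\<close>] order_tendstoD(2)[OF lim, of "bound x + e"] \<open>0 < e\<close>
      by (intro eventually_conj) auto
    then obtain b where "x < b" and
      b: "\<And>t. x < t \<Longrightarrow> t < b \<Longrightarrow> 0 < den t \<and> bound t < bound x + e"
      unfolding eventually_at_right_field by blast
    have "circular_chromatic_number G < ereal b"
      using \<open>x < b\<close> x by simp
    then obtain n d where nd: "0 < d" "2 * d \<le> n" "homomorphic_to G (circular_complete n d)"
      and less: "real n / real d < b"
      unfolding circular_chromatic_number_def Inf_less_iff by auto
    define t where "t = real n / real d"
    have "x \<le> t"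
      using circular_chromatic_number_le[OF nd] by (simp add: x t_def)
    \<comment> \<open>The right neighbourhood omits \<open>x\<close> itself, so the case that the
      ratio equals the infimum is treated separately.\<close>
    then have t: "0 < den t" "bound t \<le> bound x + e"
      using b[of t] less \<open>0 < den x\<close> \<open>0 < e\<close> by (cases "x = t"; auto simp: t_def)+
    show "circular_chromatic_number (fractional_power G (2 * r + 1) (2 * s + 1))
        \<le> ereal (bound x) + ereal e"
      using circular_chromatic_number_odd_fractional_power_le[OF _ nd t_def, of s r] t
        pair_sym_arcs order_trans
      unfolding den_def bound_def by fastforce
  qed
  then show ?thesis
    unfolding bound_def den_def x_def .
qed

end
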